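(* Let $G$ be a (matrix) Lie group. A left-invariant locally finite Borel measure on $G$ is unique up to a scalar multiple: if $m_1$ and $m_2$ are nonzero left-invariant locally finite Borel measures on $G$, then there is a constant $c>0$ such that $m_2=c\cdot m_1$.
   Context: A (matrix) Lie group is a closed subgroup of $\mathrm{GL}_d(\mathbb{R})$, with the induced topology. A Borel measure $m$ on $G$ is left-invariant if $\int_G f(gx)\,dm(x)=\int_G f(x)\,dm(x)$ for every $f\in C_c(G)$ and $g\in G$ (equivalently $m(gB)=m(B)$ for all Borel $B$), and locally finite if relatively compact Borel sets have finite measure. *)

theory Defs
  imports "HOL-Analysis.Analysis" "HOL-Algebra.Group"
begin

definition GL :: "(real^'n^'n) monoid" where
  "GL = \<lparr>carrier = {A. invertible A}, mult = (**), one = mat 1\<rparr>"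

text \<open>Closedness is relative to \<open>GL\<close>: such a group need not be closed in the space of all matrices.\<close>

definition matrix_Lie_group :: "(real^'n^'n) set \<Rightarrow> bool" where
  "matrix_Lie_group G \<longleftrightarrow> subgroup G GL \<and> closedin (top_of_set (carrier GL)) G"

definition Borel_measure_on :: "(real^'n^'n) set \<Rightarrow> (real^'n^'n) measure \<Rightarrow> bool" where
  "Borel_measure_on G m \<longleftrightarrow> sets m = sets (restrict_space borel G)"

definition relatively_compact_in :: "'a topology \<Rightarrow> 'a set \<Rightarrow> bool" where
  "relatively_compact_in X B \<longleftrightarrow> B \<subseteq> topspace X \<and> compactin X (X closure_of B)"

text \<open>Real-valued \<open>C\<^sub>c(G)\<close>. The functions are total, but only their values on \<open>G\<close> matter.\<close>

definition Cc :: "(real^'n^'n) set \<Rightarrow> (real^'n^'n \<Rightarrow> real) set" where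
  "Cc G = {f. continuous_on G f \<and> relatively_compact_in (top_of_set G) {x \<in> G. f x \<noteq> 0}}"

definition locally_finite_measure :: "(real^'n^'n) set \<Rightarrow> (real^'n^'n) measure \<Rightarrow> bool" where
  "locally_finite_measure G m \<longleftrightarrow>
    (\<forall>B \<in> sets m. relatively_compact_in (top_of_set G) B \<longrightarrow> emeasure m B < \<infinity>)"

text \<open>The Bochner integral of a non-integrable function is \<open>0\<close>, so this is meaningful only
  together with local finiteness, under which every function in \<open>C\<^sub>c(G)\<close> is integrable.\<close>

definition left_invariant_measure :: "(real^'n^'n) set \<Rightarrow> (real^'n^'n) measure \<Rightarrow> bool" where
  "left_invariant_measure G m \<longleftrightarrow>
    (\<forall>f \<in> Cc G. \<forall>g \<in> G. (\<integral>x. f (g ** x) \<partial>m) = (\<integral>x. f x \<partial>m))"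

end

theory Submission
  imports Defs
begin

text \<open>
  The heart of the matter is measure-theoretic and holds in any group with a \<open>\<sigma>\<close>-algebra for which
  multiplication and inversion are measurable. Let \<open>N\<^sub>1\<close> and \<open>N\<^sub>2\<close> be nonzero \<open>\<sigma>\<close>-finite left-invariant measures
  on it. Tonelli's theorem applied to \<open>1\<^sub>E (y\<inverse> x)\<close> gives \<open>N\<^sub>1(E) N\<^sub>2(G) = N\<^sub>2(E\<inverse>) N\<^sub>1(G)\<close> (\<open>Haar_swap\<close>).
  Hence all such measures have the same null sets, and these are stable under inversion. By the Radon--Nikodym
  theorem \<open>N\<^sub>2\<close> has a density \<open>f\<close> with respect to \<open>N\<^sub>1\<close>. Uniqueness of densities makes \<open>f\<close> left-invariant
  up to a null set for each translation (\<open>Haar_density_left_invariant\<close>), and a function with this property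
  is constant almost everywhere (\<open>left_invariant_AE_constant\<close>). The constant is the scalar sought.

  It remains to see that the measures in question fit this setting. A matrix Lie group is the intersection of
  the open set of invertible matrices with a closed set, hence a countable union of compact sets, so local
  finiteness implies \<open>\<sigma>\<close>-finiteness. Invariance is given only for integrals of functions in \<open>C\<^sub>c(G)\<close>; since
  indicators of compact sets are dominated limits of such functions, and compact sets generate the Borel
  sets, it extends to the measure itself (\<open>measure_eqI_Cc\<close>). Finally, matrix multiplication is
  continuous, and so is inversion by Cramer's rule.
\<close>

section \<open>Invariant measures on measurable groups\<close>

text \<open>The measure \<open>M\<close> serves only as a carrier of its \<open>\<sigma>\<close>-algebra: the group operations are measurable
  for it, and the measures to be compared live on the same \<open>\<sigma>\<close>-algebra.\<close>

locale measurable_group = group G for G (structure) +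
  fixes M :: "'a measure"
  assumes space_eq: "space M = carrier G"
    and mult_meas: "(\<lambda>(x, y). x \<otimes> y) \<in> M \<Otimes>\<^sub>M M \<rightarrow>\<^sub>M M"
    and inv_meas [measurable]: "(\<lambda>x. inv x) \<in> M \<rightarrow>\<^sub>M M"
begin

lemma measurable_mult [measurable (raw)]:
  assumes "f \<in> N \<rightarrow>\<^sub>M M" and "h \<in> N \<rightarrow>\<^sub>M M"
  shows "(\<lambda>x. f x \<otimes> h x) \<in> N \<rightarrow>\<^sub>M M"
  using measurable_compose[OF measurable_Pair[OF assms] mult_meas] by simp

lemma measurable_translation [measurable]:
  assumes "g \<in> carrier G"
  shows "(\<lambda>x. g \<otimes> x) \<in> M \<rightarrow>\<^sub>M M"
  using assms by (intro measurable_mult) (auto simp: space_eq)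

text \<open>In the absence of a topology, \<open>\<sigma>\<close>-finiteness takes the place of local finiteness. It is what Tonelli's
  theorem and the Radon--Nikodym theorem need.\<close>

definition Haar :: "'a measure \<Rightarrow> bool" where
  "Haar N \<longleftrightarrow> sets N = sets M \<and> sigma_finite_measure N \<and> emeasure N (carrier G) \<noteq> 0 \<and>
    (\<forall>g\<in>carrier G. distr N M (\<lambda>x. g \<otimes> x) = N)"

lemma HaarD:
  assumes "Haar N"
  shows Haar_sets: "sets N = sets M" and Haar_sigma_finite: "sigma_finite_measure N"
    and Haar_nonzero: "emeasure N (carrier G) \<noteq> 0"
    and Haar_distr: "\<And>g. g \<in> carrier G \<Longrightarrow> distr N M (\<lambda>x. g \<otimes> x) = N"
    and Haar_space: "space N = carrier G"
  using assms sets_eq_imp_space_eq[of N M] by (auto simp: Haar_def space_eq)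

lemma Haar_measurable:
  assumes "Haar N" shows "measurable N L = measurable M L"
  using Haar_sets[OF assms] by (auto intro: measurable_cong_sets)

lemma Haar_nn_integral:
  assumes N: "Haar N" and g: "g \<in> carrier G" and f: "f \<in> borel_measurable M"
  shows "(\<integral>\<^sup>+x. f (g \<otimes> x) \<partial>N) = (\<integral>\<^sup>+x. f x \<partial>N)"
proof -
  have "(\<lambda>x. g \<otimes> x) \<in> N \<rightarrow>\<^sub>M M"
    unfolding Haar_measurable[OF N] using g by (rule measurable_translation)
  then have "(\<integral>\<^sup>+x. f x \<partial>distr N M (\<lambda>x. g \<otimes> x)) = (\<integral>\<^sup>+x. f (g \<otimes> x) \<partial>N)"
    using f by (intro nn_integral_distr) auto
  then show ?thesis by (simp add: Haar_distr[OF N g])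
qed

definition inv_set :: "'a set \<Rightarrow> 'a set" where
  "inv_set E = {x \<in> carrier G. inv x \<in> E}"

lemma inv_set_sets [measurable]: "E \<in> sets M \<Longrightarrow> inv_set E \<in> sets M"
  using measurable_sets[OF inv_meas, of E] by (auto simp: inv_set_def space_eq vimage_def Int_def conj_commute)

lemma inv_set_inv_set: "E \<in> sets M \<Longrightarrow> inv_set (inv_set E) = E"
  using sets.sets_into_space[of E M] by (auto simp: inv_set_def space_eq)

text \<open>Integrate \<open>1\<^sub>E (y\<inverse> x)\<close> over both variables. Integrating first in \<open>x\<close> gives \<open>N\<^sub>1 E\<close> for every \<open>y\<close>, by
  left invariance of \<open>N\<^sub>1\<close>. Since \<open>1\<^sub>E (y\<inverse> x) = 1\<^bsub>E\<inverse>\<^esub> (x\<inverse> y)\<close>, integrating first in \<open>y\<close> gives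
  \<open>N\<^sub>2 (E\<inverse>)\<close> for every \<open>x\<close>, by left invariance of \<open>N\<^sub>2\<close>. Both total masses may be infinite.\<close>

lemma Haar_swap:
  assumes N1: "Haar N1" and N2: "Haar N2" and E: "E \<in> sets M"
  shows "emeasure N1 E * emeasure N2 (carrier G) = emeasure N2 (inv_set E) * emeasure N1 (carrier G)"
proof -
  interpret N1: sigma_finite_measure N1 by (rule Haar_sigma_finite[OF N1])
  interpret N2: sigma_finite_measure N2 by (rule Haar_sigma_finite[OF N2])
  interpret pair_sigma_finite N1 N2 ..
  note [measurable_cong] = Haar_sets[OF N1] Haar_sets[OF N2]
  note [measurable] = E
  have E1: "E \<in> sets N1" "inv_set E \<in> sets N2"
    using E inv_set_sets[OF E] by (simp_all add: Haar_sets[OF N1] Haar_sets[OF N2])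
  have "emeasure N1 E * emeasure N2 (carrier G) = (\<integral>\<^sup>+y. emeasure N1 E \<partial>N2)"
    using Haar_space[OF N2] by simp
  also have "\<dots> = (\<integral>\<^sup>+y. (\<integral>\<^sup>+x. indicator E (inv y \<otimes> x) \<partial>N1) \<partial>N2)"
  proof (rule nn_integral_cong)
    fix y assume "y \<in> space N2"
    then have "inv y \<in> carrier G" by (simp add: Haar_space[OF N2])
    then show "emeasure N1 E = (\<integral>\<^sup>+x. indicator E (inv y \<otimes> x) \<partial>N1)"
      using E1 by (subst Haar_nn_integral[OF N1]) auto
  qed
  also have "\<dots> = (\<integral>\<^sup>+x. (\<integral>\<^sup>+y. indicator E (inv y \<otimes> x) \<partial>N2) \<partial>N1)"
    by (rule Fubini') measurable
  also have "\<dots> = (\<integral>\<^sup>+x. emeasure N2 (inv_set E) \<partial>N1)"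
  proof (rule nn_integral_cong)
    fix x assume "x \<in> space N1"
    then have x: "x \<in> carrier G" by (simp add: Haar_space[OF N1])
    have "(\<integral>\<^sup>+y. indicator E (inv y \<otimes> x) \<partial>N2) = (\<integral>\<^sup>+y. indicator (inv_set E) (inv x \<otimes> y) \<partial>N2)"
      using x by (intro nn_integral_cong)
        (auto simp: Haar_space[OF N2] inv_set_def indicator_def inv_mult_group)
    also have "\<dots> = emeasure N2 (inv_set E)"
      using x E1 by (subst Haar_nn_integral[OF N2]) auto
    finally show "(\<integral>\<^sup>+y. indicator E (inv y \<otimes> x) \<partial>N2) = emeasure N2 (inv_set E)" .
  qed
  also have "\<dots> = emeasure N2 (inv_set E) * emeasure N1 (carrier G)"
    using Haar_space[OF N1] by simp
  finally show ?thesis .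
qed

text \<open>The total masses in the previous identity are nonzero, possibly \<open>\<infinity>\<close>, so a product in it vanishes
  exactly when its other factor does. With \<open>N\<^sub>1 = N\<^sub>2\<close> this says that null sets are stable under
  inversion, although the measure itself need not be.\<close>

lemma Haar_null_inv_set:
  assumes "Haar N1" and "Haar N2" and "E \<in> sets M"
  shows "emeasure N1 E = 0 \<longleftrightarrow> emeasure N2 (inv_set E) = 0"
  using Haar_swap[OF assms] Haar_nonzero[OF assms(1)] Haar_nonzero[OF assms(2)]
  by (metis mult_eq_0_iff)

text \<open>Pass from \<open>E\<close> to \<open>E\<inverse>\<close> within \<open>N\<^sub>1\<close>, and back to \<open>E\<close> while changing to \<open>N\<^sub>2\<close>.\<close>

lemma Haar_absolutely_continuous:
  assumes N1: "Haar N1" and N2: "Haar N2"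
  shows "absolutely_continuous N1 N2"
  unfolding absolutely_continuous_def
proof
  fix E assume "E \<in> null_sets N1"
  then have E: "E \<in> sets M" "emeasure N1 E = 0"
    by (auto simp: null_sets_def Haar_sets[OF N1])
  then have "emeasure N1 (inv_set E) = 0"
    using Haar_null_inv_set[OF N1 N1] by blast
  then have "emeasure N2 E = 0"
    using Haar_null_inv_set[OF N1 N2, of "inv_set E"] inv_set_inv_set[of E] inv_set_sets[of E] E by simp
  with E show "E \<in> null_sets N2" by (auto simp: null_sets_def Haar_sets[OF N2])
qed

text \<open>Translating by \<open>g\<close> preserves both \<open>N\<close> and the measure with density \<open>f\<close>, so \<open>x \<mapsto> f (g x)\<close> is another
  density of the same measure; densities with respect to a \<open>\<sigma>\<close>-finite measure are unique almost
  everywhere.\<close>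

lemma Haar_density_left_invariant:
  assumes N: "Haar N" and N': "Haar (density N f)" and f: "f \<in> borel_measurable M"
    and g: "g \<in> carrier G"
  shows "AE x in N. f (g \<otimes> x) = f x"
proof -
  interpret N: sigma_finite_measure N by (rule Haar_sigma_finite[OF N])
  note [measurable_cong] = Haar_sets[OF N]
  note [measurable] = f measurable_translation[OF g] measurable_translation[OF inv_closed[OF g]]
  have "density N (\<lambda>x. f (g \<otimes> x)) = density N f"
  proof (rule measure_eqI)
    fix E assume "E \<in> sets (density N (\<lambda>x. f (g \<otimes> x)))"
    then have E: "E \<in> sets M" by (simp add: Haar_sets[OF N])
    note [measurable] = E
    have "emeasure (density N (\<lambda>x. f (g \<otimes> x))) E = (\<integral>\<^sup>+x. f (g \<otimes> x) * indicator E x \<partial>N)"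
      using E by (subst emeasure_density) (auto simp: Haar_sets[OF N])
    also have "\<dots> = (\<integral>\<^sup>+x. f (g \<otimes> x) * indicator E (inv g \<otimes> (g \<otimes> x)) \<partial>N)"
      using g by (intro nn_integral_cong) (simp add: Haar_space[OF N] m_assoc[symmetric])
    also have "\<dots> = (\<integral>\<^sup>+x. f x * indicator E (inv g \<otimes> x) \<partial>N)"
      by (rule Haar_nn_integral[OF N g]) measurable
    also have "\<dots> = (\<integral>\<^sup>+x. indicator E (inv g \<otimes> x) \<partial>density N f)"
      by (subst nn_integral_density) simp_all
    also have "\<dots> = emeasure (density N f) E"
      using g E by (subst Haar_nn_integral[OF N']) (auto simp: Haar_sets[OF N])
    finally show "emeasure (density N (\<lambda>x. f (g \<otimes> x))) E = emeasure (density N f) E" .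
  qed simp
  then show ?thesis
    by (subst N.density_unique_iff[symmetric]) measurable
qed

text \<open>The exceptional null set of the hypothesis depends on \<open>g\<close>. Tonelli's theorem exchanges the quantifiers
  and yields one point \<open>x\<close> with \<open>f (g x) = f x\<close> for almost every \<open>g\<close>. As \<open>g\<close> varies, \<open>g x\<close> runs over the
  group by right translation, which \<open>N\<close> need not preserve; but inversion preserves null sets and turns right
  into left translation, so the exceptional set of \<open>f\<close> itself is null.\<close>

lemma left_invariant_AE_constant:
  fixes f :: "'a \<Rightarrow> ennreal"
  assumes N: "Haar N" and f: "f \<in> borel_measurable M"
    and inv: "\<And>g. g \<in> carrier G \<Longrightarrow> AE x in N. f (g \<otimes> x) = f x"
  obtains c where "AE x in N. f x = c"
proof -
  interpret N: sigma_finite_measure N by (rule Haar_sigma_finite[OF N])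
  interpret pair_sigma_finite N N ..
  note [measurable_cong] = Haar_sets[OF N]
  note [measurable] = f
  have "AE g in N. AE x in N. f (g \<otimes> x) = f x"
    by (rule AE_I2) (simp add: inv Haar_space[OF N])
  then have ae: "AE x in N. AE g in N. f (g \<otimes> x) = f x"
    by (subst AE_commute[symmetric]) measurable
  have "\<not> (AE x in N. False)"
    using Haar_nonzero[OF N] Haar_space[OF N] sets.top[of N] by (subst AE_iff_measurable[OF _ refl]) auto
  moreover have "AE x in N. False" if "\<not> (\<exists>x\<in>carrier G. AE g in N. f (g \<otimes> x) = f x)"
    by (rule AE_mp[OF ae], rule AE_I2) (use that Haar_space[OF N] in auto)
  ultimately obtain x where x: "x \<in> carrier G" and aex: "AE g in N. f (g \<otimes> x) = f x"
    by blast
  define A where "A = {y \<in> carrier G. f y \<noteq> f x}"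
  have A: "A \<in> sets M"
    unfolding A_def space_eq[symmetric] by measurable
  \<comment> \<open>With \<open>A\<close> the exceptional set of \<open>f\<close>, this is \<open>A x\<inverse>\<close>, whose inverse \<open>x A\<inverse>\<close> is a left translate.\<close>
  define T where "T = {g \<in> carrier G. f (g \<otimes> x) \<noteq> f x}"
  have T: "T \<in> sets M"
  proof -
    have [measurable]: "x \<in> space M" using x by (simp add: space_eq)
    show ?thesis unfolding T_def space_eq[symmetric] by measurable
  qed
  have "emeasure N T = 0"
    using aex T by (subst (asm) AE_iff_measurable[of T]) (auto simp: T_def Haar_space[OF N] Haar_sets[OF N])
  then have "emeasure N (inv_set T) = 0"
    using Haar_null_inv_set[OF N N T] by simp
  moreover have "emeasure N (inv_set T) = emeasure N (inv_set A)"
  proof -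
    have meas: "inv_set T \<in> sets N" "inv_set A \<in> sets N"
      using A T by (auto simp: Haar_sets[OF N])
    have "emeasure N (inv_set T) = (\<integral>\<^sup>+h. indicator (inv_set A) (inv x \<otimes> h) \<partial>N)"
      unfolding nn_integral_indicator[OF meas(1), symmetric] using x
      by (intro nn_integral_cong)
        (auto simp: indicator_def inv_set_def A_def T_def Haar_space[OF N] inv_mult_group)
    also have "\<dots> = emeasure N (inv_set A)"
      using x A meas by (subst Haar_nn_integral[OF N]) auto
    finally show ?thesis .
  qed
  ultimately have "emeasure N A = 0"
    using Haar_null_inv_set[OF N N A] by simp
  then have "AE y in N. f y = f x"
    using A by (subst AE_iff_measurable[of A]) (auto simp: A_def Haar_space[OF N] Haar_sets[OF N])
  then show thesis by (rule that)
qed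

text \<open>The Radon--Nikodym derivative is constant almost everywhere. The constant is not \<open>0\<close> because \<open>N\<^sub>2\<close> is
  nonzero, and not \<open>\<infinity>\<close> because otherwise \<open>N\<^sub>2\<close> would take only the values \<open>0\<close> and \<open>\<infinity>\<close>, which a nonzero
  \<open>\<sigma>\<close>-finite measure does not.\<close>

theorem Haar_unique:
  assumes N1: "Haar N1" and N2: "Haar N2"
  shows "\<exists>c::real. c > 0 \<and> N2 = scale_measure (ennreal c) N1"
proof -
  interpret N1: sigma_finite_measure N1 by (rule Haar_sigma_finite[OF N1])
  interpret N2: sigma_finite_measure N2 by (rule Haar_sigma_finite[OF N2])
  have sets_eq: "sets N2 = sets N1" by (simp add: Haar_sets[OF N1] Haar_sets[OF N2])
  obtain f where f1: "f \<in> borel_measurable N1" and dens: "density N1 f = N2"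
    using N1.Radon_Nikodym[OF Haar_absolutely_continuous[OF N1 N2] sets_eq] by blast
  then have f: "f \<in> borel_measurable M" by (simp add: Haar_measurable[OF N1])
  obtain c where c: "AE x in N1. f x = c"
    using left_invariant_AE_constant[OF N1 f] Haar_density_left_invariant[OF N1 _ f] N2 dens by metis
  have N2_eq: "emeasure N2 E = c * emeasure N1 E" if "E \<in> sets N1" for E
  proof -
    have "density N1 f = density N1 (\<lambda>_. c)"
      using c f1 by (intro density_cong) auto
    then show ?thesis
      using that dens by (metis emeasure_density_const)
  qed
  have "c \<noteq> 0"
    using N2_eq[of "carrier G"] Haar_nonzero[OF N2] Haar_space[OF N1] sets.top[of N1] by auto
  moreover have "c \<noteq> \<infinity>"
  proof
    assume "c = \<infinity>"
    obtain A :: "nat \<Rightarrow> 'a set"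
      where A: "range A \<subseteq> sets N2" "(\<Union>i. A i) = space N2" "\<And>i. emeasure N2 (A i) \<noteq> \<infinity>"
      using N2.sigma_finite by blast
    have "emeasure N1 (A i) = 0" for i
      using A(1) A(3)[of i] N2_eq[of "A i"] \<open>c = \<infinity>\<close> sets_eq
      by (auto simp: ennreal_top_mult split: if_splits)
    then have "emeasure N1 (\<Union>i. A i) = 0"
      using A(1) sets_eq by (intro emeasure_UN_eq_0) auto
    then show False
      using A(2) Haar_nonzero[OF N1] Haar_space[OF N2] by simp
  qed
  ultimately obtain r where r: "r > 0" "c = ennreal r"
    by (cases c) (auto simp: ennreal_eq_0_iff)
  then show ?thesis
    using N2_eq sets_eq by (intro exI[of _ r] conjI measure_eqI) auto
qed

end

section \<open>Topology of the general linear group\<close>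

lemma carrier_GL: "carrier GL = {A. invertible A}" by (simp add: GL_def)

lemma continuous_on_det:
  fixes f :: "'a::topological_space \<Rightarrow> real^'n^'n"
  assumes "\<And>i j. continuous_on S (\<lambda>x. f x $ i $ j)"
  shows "continuous_on S (\<lambda>x. det (f x))"
  unfolding det_def by (intro continuous_intros assms)

lemma open_GL: "open (carrier (GL :: (real^'n^'n) monoid))"
proof -
  have "carrier (GL :: (real^'n^'n) monoid) = (\<lambda>A. det A) -` (- {0})"
    by (auto simp: carrier_GL invertible_det_nz)
  moreover have "continuous_on UNIV (\<lambda>A::real^'n^'n. det A)"
    by (intro continuous_on_det continuous_on_component continuous_on_id)
  ultimately show ?thesis
    by (metis open_vimage open_Compl closed_singleton)
qed

lemma group_GL: "group (GL :: (real^'n^'n) monoid)"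
proof (rule groupI)
  fix x :: "real^'n^'n" assume "x \<in> carrier GL"
  then obtain y where "x ** y = mat 1" "y ** x = mat 1" by (auto simp: GL_def invertible_def)
  then show "\<exists>y\<in>carrier GL. y \<otimes>\<^bsub>GL\<^esub> x = \<one>\<^bsub>GL\<^esub>"
    by (auto simp: GL_def invertible_def intro!: bexI[of _ y])
next
  show "\<one>\<^bsub>GL\<^esub> \<in> carrier (GL :: (real^'n^'n) monoid)"
    by (simp add: GL_def invertible_det_nz)
qed (simp_all add: GL_def invertible_mult matrix_mul_assoc)

lemma continuous_on_matrix_mult [continuous_intros]:
  fixes f g :: "'a::topological_space \<Rightarrow> real^'n^'n"
  assumes "continuous_on S f" "continuous_on S g"
  shows "continuous_on S (\<lambda>x. f x ** g x)"
  unfolding matrix_matrix_mult_def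
  by (intro continuous_on_vec_lambda continuous_intros assms)

lemma matrix_mult_matrix_inv:
  fixes A :: "real^'n^'n"
  assumes "invertible A" shows "A ** matrix_inv A = mat 1" "matrix_inv A ** A = mat 1"
proof -
  have "\<exists>A'. A ** A' = mat 1 \<and> A' ** A = mat 1" using assms by (simp add: invertible_def)
  from someI_ex[OF this] show "A ** matrix_inv A = mat 1" "matrix_inv A ** A = mat 1"
    by (auto simp: matrix_inv_def)
qed

lemma inv_GL:
  assumes "A \<in> carrier GL" shows "inv\<^bsub>GL\<^esub> A = matrix_inv A"
proof -
  interpret group GL by (rule group_GL)
  from assms show ?thesis
    using matrix_mult_matrix_inv[of A]
    by (intro inv_equality) (auto simp: GL_def invertible_def)
qed

text \<open>Cramer's rule for each column of the inverse; it exhibits the entries of the inverse as rational functions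
  of the entries of the matrix, hence as continuous functions.\<close>

lemma matrix_inv_cramer:
  fixes A :: "real^'n^'n"
  assumes "invertible A"
  shows "matrix_inv A $ k $ l = det (\<chi> i j. if j = k then axis l 1 $ i else A $ i $ j) / det A"
proof -
  have "A *v (matrix_inv A *v axis l 1) = axis l 1"
    by (simp add: matrix_vector_mul_assoc matrix_mult_matrix_inv[OF assms])
  then have "matrix_inv A *v axis l 1 =
      (\<chi> k. det (\<chi> i j. if j = k then axis l 1 $ i else A $ i $ j) / det A)"
    using assms by (subst cramer[symmetric]) (auto simp: invertible_det_nz)
  then show ?thesis
    by (simp add: matrix_vector_mult_basis column_def vec_eq_iff)
qed

lemma continuous_on_matrix_inv:
  "continuous_on (carrier GL) (matrix_inv :: real^'n^'n \<Rightarrow> real^'n^'n)"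
proof -
  have "continuous_on {A. invertible A} (\<lambda>A::real^'n^'n. \<chi> k l. 
      det (\<chi> i j. if j = k then axis l 1 $ i else A $ i $ j) / det A)"
  proof (rule continuous_on_vec_lambda, rule continuous_on_vec_lambda)
    fix k l :: 'n
    have entry: "continuous_on {A. invertible A}
        (\<lambda>A::real^'n^'n. (\<chi> i j. if j = k then axis l 1 $ i else A $ i $ j) $ i $ j)" for i j
      by (cases "j = k") (simp_all add: continuous_on_component)
    show "continuous_on {A. invertible A}
        (\<lambda>A::real^'n^'n. det (\<chi> i j. if j = k then axis l 1 $ i else A $ i $ j) / det A)"
    proof (rule continuous_on_divide)
      show "continuous_on {A. invertible A} (\<lambda>A::real^'n^'n. det A)"
        by (intro continuous_on_det continuous_on_component continuous_on_id)
      show "continuous_on {A. invertible A}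
          (\<lambda>A::real^'n^'n. det (\<chi> i j. if j = k then axis l 1 $ i else A $ i $ j))"
        by (rule continuous_on_det) (rule entry)
    qed (simp add: invertible_det_nz)
  qed
  then show ?thesis
    unfolding carrier_GL by (rule continuous_on_eq) (auto simp: vec_eq_iff matrix_inv_cramer)
qed

section \<open>Measures determined by integrals of compactly supported functions\<close>

lemma locally_closed_sigma_compact:
  fixes U C :: "'a::euclidean_space set"
  assumes "open U" and "closed C"
  obtains K :: "nat \<Rightarrow> 'a set" where "\<And>n. compact (K n)" "(\<Union>n. K n) = U \<inter> C"
proof -
  obtain K :: "nat \<Rightarrow> 'a set" where K: "\<And>n. compact (K n)" "\<Union>(range K) = U"
    using open_Union_compact_subsets[OF \<open>open U\<close>] by metis
  show thesis
    by (rule that[of "\<lambda>n. K n \<inter> C"]) (use K \<open>closed C\<close> in \<open>auto intro: compact_Int_closed\<close>)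
qed

text \<open>A relatively open subset of \<open>U \<inter> C\<close> is again the intersection of an open and a closed set, hence a
  countable union of compact sets. The compact sets therefore form an intersection-stable generator of
  the Borel sets, on which two locally finite measures can be compared.\<close>

lemma sets_restrict_borel_eq_sigma_compact:
  fixes U C :: "'a::euclidean_space set"
  assumes "open U" and "closed C"
  shows "sets (restrict_space borel (U \<inter> C)) = sigma_sets (U \<inter> C) {K. compact K \<and> K \<subseteq> U \<inter> C}"
    (is "sets (restrict_space borel ?G) = sigma_sets ?G ?E")
proof
  have space: "space (sigma ?G ?E) = ?G" and sets: "sets (sigma ?G ?E) = sigma_sets ?G ?E"
    by (rule space_measure_of, blast) (rule sets_measure_of, blast)
  have "(\<lambda>x. x) \<in> borel_measurable (sigma ?G ?E)"
  proof (rule borel_measurableI)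
    fix S :: "'a set" assume "open S"
    then obtain K :: "nat \<Rightarrow> 'a set" where K: "\<And>n. compact (K n)" "(\<Union>n. K n) = (S \<inter> U) \<inter> C"
      using locally_closed_sigma_compact[of "S \<inter> U" C] assms by (metis open_Int)
    have "(\<Union>n. K n) \<in> sigma_sets ?G ?E"
      using K by (intro sigma_sets.Union sigma_sets.Basic) blast
    then show "(\<lambda>x. x) -` S \<inter> space (sigma ?G ?E) \<in> sets (sigma ?G ?E)"
      unfolding space sets K(2) by (simp add: Int_assoc)
  qed
  then have "A \<inter> ?G \<in> sigma_sets ?G ?E" if "A \<in> sets borel" for A
    using measurable_sets[OF _ that, of "\<lambda>x. x" "sigma ?G ?E"] space sets by simp
  then show "sets (restrict_space borel ?G) \<subseteq> sigma_sets ?G ?E"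
    by (auto simp: sets_restrict_space Int_commute)
  have "K \<in> sets (restrict_space borel ?G)" if "K \<in> ?E" for K
    using that by (auto simp: sets_restrict_space borel_compact intro!: image_eqI[of _ _ K])
  then show "sigma_sets ?G ?E \<subseteq> sets (restrict_space borel ?G)"
    using sets.sigma_sets_subset[of ?E "restrict_space borel ?G"] by (auto simp: space_restrict_space)
qed

lemma relatively_compact_inI:
  fixes G L :: "'a::t2_space set"
  assumes "compact L" and "L \<subseteq> G" and "B \<subseteq> L"
  shows "relatively_compact_in (top_of_set G) B"
proof -
  have L: "compactin (top_of_set G) L"
    using assms by (simp add: compactin_subtopology)
  have "closedin (top_of_set G) L"
    using assms by (metis closed_subset compact_imp_closed)
  then have "top_of_set G closure_of B \<subseteq> L"
    using assms by (intro closure_of_minimal)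
  then show ?thesis
    unfolding relatively_compact_in_def
    using L assms closed_compactin[OF L _ closedin_closure_of] by auto
qed

text \<open>The functions \<open>max 0 (1 - (n + 1) d(x, K) / e)\<close>, continuous on the whole space, decrease to the indicator
  of \<open>K\<close>. For \<open>e\<close> so small that the closed \<open>e\<close>-neighbourhood of \<open>K\<close> lies in \<open>U\<close>, the part of that
  neighbourhood in \<open>C\<close> is compact; it contains their supports in \<open>U \<inter> C\<close> and dominates them all.\<close>

lemma ex_Cc_approximation_indicator:
  fixes U C :: "(real^'n^'n) set"
  assumes "open U" and "closed C" and K: "compact K" "K \<subseteq> U \<inter> C" "K \<noteq> {}"
  obtains f :: "nat \<Rightarrow> real^'n^'n \<Rightarrow> real" and L
  where "compact L" "L \<subseteq> U \<inter> C" "\<And>n. f n \<in> Cc (U \<inter> C)" "\<And>n. continuous_on UNIV (f n)"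
    "\<And>n x. x \<in> U \<inter> C \<Longrightarrow> \<bar>f n x\<bar> \<le> indicator L x"
    "\<And>x. (\<lambda>n. f n x) \<longlonglongrightarrow> indicator K x"
proof -
  obtain e where e: "e > 0" "(\<Union>x\<in>K. cball x e) \<subseteq> U"
    using compact_subset_open_imp_cball_epsilon_subset[OF K(1) \<open>open U\<close>] K(2) by blast
  define L where "L = {x. infdist x K \<le> e} \<inter> C"
  have L: "compact L"
    unfolding L_def using compact_infdist_le[OF K(3,1) e(1)] \<open>closed C\<close> by (rule compact_Int_closed)
  have "x \<in> U" if "infdist x K \<le> e" for x
  proof -
    obtain y where "y \<in> K" "infdist x K = dist x y"
      using infdist_attains_inf[of K x] K compact_imp_closed by metis
    then have "x \<in> cball y e" using that by (simp add: dist_commute)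
    then show ?thesis using e(2) \<open>y \<in> K\<close> by blast
  qed
  then have LG: "L \<subseteq> U \<inter> C" by (auto simp: L_def)
  define f :: "nat \<Rightarrow> real^'n^'n \<Rightarrow> real" where "f n x = max 0 (1 - real (Suc n) * (infdist x K / e))" for n x
  have supp: "infdist x K \<le> e" if "f n x \<noteq> 0" for n x
  proof (rule ccontr)
    assume "\<not> infdist x K \<le> e"
    then have "1 \<le> infdist x K / e" using e by simp
    moreover then have "infdist x K / e \<le> real (Suc n) * (infdist x K / e)"
      by (intro mult_le_cancel_right1[THEN iffD2]) auto
    ultimately show False using that by (simp add: f_def)
  qed
  have f01: "0 \<le> f n x" "f n x \<le> 1" for n x
    using e by (auto simp: f_def infdist_nonneg)
  have cont: "continuous_on UNIV (f n)" for n
    unfolding f_def using e by (intro continuous_intros) auto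
  show thesis
  proof (rule that[OF L LG])
    fix n
    have "{x \<in> U \<inter> C. f n x \<noteq> 0} \<subseteq> L" using supp by (auto simp: L_def)
    from relatively_compact_inI[OF L LG this] show "f n \<in> Cc (U \<inter> C)"
      using continuous_on_subset[OF cont] by (auto simp: Cc_def)
    show "continuous_on UNIV (f n)" by (rule cont)
  next
    fix n x assume "x \<in> U \<inter> C"
    then show "\<bar>f n x\<bar> \<le> indicator L x"
      using f01[of n x] supp[of n x] by (cases "f n x = 0") (auto simp: L_def indicator_def)
  next
    fix x
    show "(\<lambda>n. f n x) \<longlonglongrightarrow> indicator K x"
    proof (cases "x \<in> K")
      case True
      then show ?thesis by (simp add: f_def)
    next
      case False
      then have pos: "infdist x K / e > 0"
        using in_closed_iff_infdist_zero[of K x] K e compact_imp_closed[of K] infdist_nonneg[of x K]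
        by (simp add: less_le)
      obtain n0 :: nat where n0: "1 < real n0 * (infdist x K / e)"
        using reals_Archimedean3[OF pos] by blast
      have "f n x = 0" if "n \<ge> n0" for n
      proof -
        have "real n0 * (infdist x K / e) \<le> real (Suc n) * (infdist x K / e)"
          using that pos by (intro mult_right_mono) auto
        then show ?thesis using n0 by (simp add: f_def)
      qed
      then show ?thesis
        using False by (intro tendsto_eventually eventually_sequentiallyI[of n0]) auto
    qed
  qed
qed

text \<open>The uniqueness half of the Riesz representation theorem. By dominated convergence, the integrals of
  compactly supported functions determine the measures of compact sets, and these generate the Borel sets.
  The test functions are moreover continuous on the whole space, as the approximations of indicators are;
  so the hypothesis on their integrals need only be verified for Borel functions.\<close>

lemma measure_eqI_Cc:
  fixes U C :: "(real^'n^'n) set" and m m' :: "(real^'n^'n) measure"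
  defines "G \<equiv> U \<inter> C"
  assumes UC: "open U" "closed C"
    and sets: "sets m = sets (restrict_space borel G)" "sets m' = sets (restrict_space borel G)"
    and fin: "\<And>K. compact K \<Longrightarrow> K \<subseteq> G \<Longrightarrow> emeasure m K < \<infinity>"
      "\<And>K. compact K \<Longrightarrow> K \<subseteq> G \<Longrightarrow> emeasure m' K < \<infinity>"
    and eq: "\<And>f. f \<in> Cc G \<Longrightarrow> continuous_on UNIV f \<Longrightarrow> (\<integral>x. f x \<partial>m) = (\<integral>x. f x \<partial>m')"
  shows "m = m'"
proof -
  let ?E = "{K. compact K \<and> K \<subseteq> G}"
  have gen: "sets (restrict_space borel G) = sigma_sets G ?E"
    unfolding G_def by (rule sets_restrict_borel_eq_sigma_compact[OF UC])
  obtain A :: "nat \<Rightarrow> (real^'n^'n) set" where A: "\<And>n. compact (A n)" "(\<Union>n. A n) = G"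
    using locally_closed_sigma_compact[OF UC] unfolding G_def by blast
  show ?thesis
  proof (rule measure_eqI_generator_eq[where E = ?E and \<Omega> = G and A = A])
    show "Int_stable ?E" by (auto simp: Int_stable_def compact_Int)
    show "range A \<subseteq> ?E" using A by auto
    show "emeasure m (A i) \<noteq> \<infinity>" for i
      using fin(1)[of "A i"] A(1)[of i] UN_upper[of i UNIV A] unfolding A(2) by auto
    fix K assume "K \<in> ?E"
    then have K: "compact K" "K \<subseteq> G" by auto
    show "emeasure m K = emeasure m' K"
    proof (cases "K = {}")
      case False
      obtain f :: "nat \<Rightarrow> real^'n^'n \<Rightarrow> real" and L
        where L: "compact L" "L \<subseteq> G" and f: "\<And>n. f n \<in> Cc G" "\<And>n. continuous_on UNIV (f n)"
          "\<And>n x. x \<in> G \<Longrightarrow> \<bar>f n x\<bar> \<le> indicator L x"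
          "\<And>x. (\<lambda>n. f n x) \<longlonglongrightarrow> indicator K x"
        by (rule ex_Cc_approximation_indicator[OF UC, of K, folded G_def, OF K False]) (rule that)
      have lim: "(\<lambda>n. \<integral>x. f n x \<partial>N) \<longlonglongrightarrow> measure N K"
        if N: "sets N = sets (restrict_space borel G)"
          and finN: "\<And>K. compact K \<Longrightarrow> K \<subseteq> G \<Longrightarrow> emeasure N K < \<infinity>" for N
      proof -
        have space: "space N = G"
          using sets_eq_imp_space_eq[OF N] by (simp add: space_restrict_space)
        have KL: "K \<in> sets N" "L \<in> sets N"
          using K L unfolding N gen by (auto intro: sigma_sets.Basic)
        have "(\<lambda>n. \<integral>x. f n x \<partial>N) \<longlonglongrightarrow> (\<integral>x. indicator K x \<partial>N)"
        proof (rule integral_dominated_convergence[where w = "indicator L"])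
          show "f n \<in> borel_measurable N" for n
            unfolding measurable_cong_sets[OF N refl]
            by (intro borel_measurable_continuous_on_restrict continuous_on_subset[OF f(2)]) auto
          show "integrable N (indicator L :: _ \<Rightarrow> real)"
            using finN[OF L] KL by simp
        qed (use KL f(3,4) space in auto)
        then show ?thesis using K space by (simp add: Int_absorb2)
      qed
      have "measure m K = measure m' K"
        using lim[OF sets(1) fin(1)] lim[OF sets(2) fin(2)] eq[OF f(1,2)] LIMSEQ_unique by simp
      then show ?thesis
        using fin(1)[of K] fin(2)[of K] K by (simp add: emeasure_eq_ennreal_measure)
    qed simp
  next
    show "?E \<subseteq> Pow G" by auto
  qed (simp_all only: sets gen A(2))
qed

section \<open>Matrix Lie groups\<close>

text \<open>As \<open>GL\<close> is open in the space of matrices, a matrix Lie group is the intersection of an open and a closed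
  set.\<close>

lemma matrix_Lie_group_locally_closed:
  assumes "matrix_Lie_group G"
  obtains C where "closed C" "G = carrier GL \<inter> C"
  using assms unfolding matrix_Lie_group_def by (auto simp: closedin_closed)

lemma matrix_Lie_group_measurable_group:
  assumes "matrix_Lie_group G"
  shows "measurable_group (GL\<lparr>carrier := G\<rparr>) (restrict_space borel G)"
proof -
  let ?M = "restrict_space borel G"
  have sub: "subgroup G GL" using assms by (simp add: matrix_Lie_group_def)
  interpret H: group "GL\<lparr>carrier := G\<rparr>"
    using sub group_GL by (rule subgroup.subgroup_is_group)
  have id: "(\<lambda>x. x) \<in> borel_measurable ?M" by (rule measurable_restrict_space1) simp
  have inv_eq: "inv\<^bsub>GL\<lparr>carrier := G\<rparr>\<^esub> x = matrix_inv x" if "x \<in> G" for x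
    using group.m_inv_consistent[OF group_GL sub that] inv_GL[of x] subgroup.subset[OF sub] that by auto
  show ?thesis
  proof unfold_locales
    show "space ?M = carrier (GL\<lparr>carrier := G\<rparr>)" by (simp add: space_restrict_space)
    have "(\<lambda>p. fst p ** snd p) \<in> borel_measurable (?M \<Otimes>\<^sub>M ?M)"
    proof (rule borel_measurable_continuous_Pair[where H = "(**)" and f = fst and g = snd])
      show "fst \<in> borel_measurable (?M \<Otimes>\<^sub>M ?M)"
        by (rule measurable_compose[OF measurable_fst id])
      show "snd \<in> borel_measurable (?M \<Otimes>\<^sub>M ?M)"
        by (rule measurable_compose[OF measurable_snd id])
    qed (intro continuous_intros)
    then show "(\<lambda>(x, y). x \<otimes>\<^bsub>GL\<lparr>carrier := G\<rparr>\<^esub> y) \<in> ?M \<Otimes>\<^sub>M ?M \<rightarrow>\<^sub>M ?M"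
      using H.m_closed
      by (intro measurable_restrict_space2)
        (auto simp: space_pair_measure space_restrict_space GL_def case_prod_beta)
    have "matrix_inv \<in> borel_measurable ?M"
      using continuous_on_subset[OF continuous_on_matrix_inv subgroup.subset[OF sub]]
      by (rule borel_measurable_continuous_on_restrict)
    then have "(\<lambda>x. inv\<^bsub>GL\<lparr>carrier := G\<rparr>\<^esub> x) \<in> borel_measurable ?M"
      by (subst measurable_cong[of _ _ matrix_inv]) (auto simp: inv_eq space_restrict_space)
    then show "(\<lambda>x. inv\<^bsub>GL\<lparr>carrier := G\<rparr>\<^esub> x) \<in> ?M \<rightarrow>\<^sub>M ?M"
      using H.inv_closed by (intro measurable_restrict_space2) (auto simp: space_restrict_space)
  qed
qed

text \<open>Invariance of integrals says that \<open>m\<close> and its image under a translation agree on \<open>C\<^sub>c(G)\<close>, hence are equal.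
  The image is finite on compact sets since the preimage of a compact set \<open>K\<close> under translation by \<open>g\<close> is the
  compact set \<open>g\<inverse> K\<close>. A countable compact cover of \<open>G\<close> gives \<open>\<sigma>\<close>-finiteness.\<close>

lemma left_invariant_measure_Haar:
  fixes G :: "(real^'n^'n) set"
  assumes G: "matrix_Lie_group G" and B: "Borel_measure_on G m" and inv: "left_invariant_measure G m"
    and fin: "locally_finite_measure G m" and nz: "emeasure m G \<noteq> 0"
  shows "measurable_group.Haar (GL\<lparr>carrier := G\<rparr>) (restrict_space borel G) m"
proof -
  let ?M = "restrict_space borel G"
  interpret measurable_group "GL\<lparr>carrier := G\<rparr>" ?M
    by (rule matrix_Lie_group_measurable_group[OF G])
  obtain C where C: "closed C" and G_eq: "G = carrier GL \<inter> C"
    using matrix_Lie_group_locally_closed[OF G] .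
  have sets: "sets m = sets ?M" using B by (simp add: Borel_measure_on_def)
  have space: "space m = G" using sets_eq_imp_space_eq[OF sets] by (simp add: space_restrict_space)
  have compact_sets: "K \<in> sets m" if "compact K" "K \<subseteq> G" for K
    using that unfolding sets G_eq sets_restrict_borel_eq_sigma_compact[OF open_GL C]
    by (auto intro: sigma_sets.Basic)
  have compact_fin: "emeasure m K < \<infinity>" if "compact K" "K \<subseteq> G" for K
    using fin compact_sets[OF that] relatively_compact_inI[OF that order_refl]
    by (auto simp: locally_finite_measure_def)
  have "sigma_finite_measure m"
  proof
    obtain K :: "nat \<Rightarrow> (real^'n^'n) set" where K: "\<And>n. compact (K n)" "(\<Union>n. K n) = G"
      using locally_closed_sigma_compact[OF open_GL C] unfolding G_eq by blast
    then have "K n \<subseteq> G" for n by blast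
    then show "\<exists>A. countable A \<and> A \<subseteq> sets m \<and> \<Union>A = space m \<and> (\<forall>a\<in>A. emeasure m a \<noteq> \<infinity>)"
      using K compact_sets compact_fin space
      by (intro exI[of _ "range K"]) (auto simp: less_top)
  qed
  moreover have "distr m ?M (\<lambda>x. g ** x) = m" if g: "g \<in> G" for g
  proof -
    have transl: "(\<lambda>x. g ** x) \<in> m \<rightarrow>\<^sub>M ?M"
      using measurable_translation[of g] g by (simp add: measurable_cong_sets[OF sets refl] GL_def)
    define h where "h = inv\<^bsub>GL\<lparr>carrier := G\<rparr>\<^esub> g"
    have h: "h \<in> G" using inv_closed[of g] g by (simp add: h_def)
    have hg: "h ** g = mat 1" "g ** h = mat 1"
      using l_inv[of g] r_inv[of g] g by (simp_all add: h_def GL_def)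
    have closed: "x ** y \<in> G" if "x \<in> G" "y \<in> G" for x y
      using m_closed[of x y] that by (simp add: GL_def)
    show ?thesis
      unfolding G_eq
    proof (rule measure_eqI_Cc[OF open_GL C], fold G_eq)
      show "sets (distr m ?M (\<lambda>x. g ** x)) = sets ?M" "sets m = sets ?M" using sets by simp_all
      fix K assume K: "compact K" "K \<subseteq> G"
      show "emeasure m K < \<infinity>" by (rule compact_fin[OF K])
      have "compact ((\<lambda>x. h ** x) ` K)"
        using K by (intro compact_continuous_image continuous_intros)
      moreover have "(\<lambda>x. h ** x) ` K \<subseteq> G" using K h closed by blast
      moreover have "(\<lambda>x. g ** x) -` K \<inter> space m = (\<lambda>x. h ** x) ` K"
      proof (intro equalityI subsetI)
        fix x assume "x \<in> (\<lambda>x. g ** x) -` K \<inter> space m"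
        then show "x \<in> (\<lambda>x. h ** x) ` K"
          by (intro image_eqI[of _ _ "g ** x"]) (auto simp: matrix_mul_assoc hg)
      next
        fix x assume "x \<in> (\<lambda>x. h ** x) ` K"
        then show "x \<in> (\<lambda>x. g ** x) -` K \<inter> space m"
          using K h closed by (auto simp: matrix_mul_assoc hg space)
      qed
      ultimately show "emeasure (distr m ?M (\<lambda>x. g ** x)) K < \<infinity>"
        using compact_fin compact_sets[OF K] by (simp add: emeasure_distr[OF transl] sets)
    next
      fix f assume f: "f \<in> Cc G" "continuous_on UNIV f"
      have "f \<in> borel_measurable ?M"
        by (intro borel_measurable_continuous_on_restrict continuous_on_subset[OF f(2)]) auto
      then have "(\<integral>x. f x \<partial>distr m ?M (\<lambda>x. g ** x)) = (\<integral>x. f (g ** x) \<partial>m)"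
        by (rule integral_distr[OF transl])
      also have "\<dots> = (\<integral>x. f x \<partial>m)"
        using inv f(1) g by (auto simp: left_invariant_measure_def)
      finally show "(\<integral>x. f x \<partial>distr m ?M (\<lambda>x. g ** x)) = (\<integral>x. f x \<partial>m)" .
    qed
  qed
  ultimately show ?thesis
    using sets nz by (simp add: Haar_def) (simp add: GL_def)
qed

theorem theorem2p1:
  fixes G :: "(real^'n^'n) set"
    and m\<^sub>1 m\<^sub>2 :: "(real^'n^'n) measure"
  assumes "matrix_Lie_group G"
    and "Borel_measure_on G m\<^sub>1" and "left_invariant_measure G m\<^sub>1"
    and "locally_finite_measure G m\<^sub>1" and "emeasure m\<^sub>1 G \<noteq> 0"
    and "Borel_measure_on G m\<^sub>2" and "left_invariant_measure G m\<^sub>2"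
    and "locally_finite_measure G m\<^sub>2" and "emeasure m\<^sub>2 G \<noteq> 0"
  shows "\<exists>c::real. c > 0 \<and> m\<^sub>2 = scale_measure (ennreal c) m\<^sub>1"
  using assms
  by (intro measurable_group.Haar_unique[OF matrix_Lie_group_measurable_group]
      left_invariant_measure_Haar)

end
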